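(* Let $K\subseteq\mathbb{R}^d$ and let $C\subseteq\mathbb{R}^d$ be a compact convex set with non-empty interior such that $0\in\operatorname{int}(C)$. Then $$2\sup\left\{\frac{h_{K-K}(u)}{h_{C-C}(u)} : u\in\mathbb{R}^d\setminus\{0\}\right\} = 2\sup\{R(\{x,y\},C) : x,y\in K\} = R\left(K-K,\tfrac12(C-C)\right)$$ and $$R\left(K-K,\tfrac12(C-C)\right)\le R(K-K,C)\le \sup\{\gamma_C(x-y) : x,y\in K\},$$ with equality throughout if $C=-C$. If $K$ is a non-empty closed convex set, then also $$\sup\{R(\{x,y\},C) : x,y\in K\}=\sup\left\{\frac{l_K(u)}{l_C(u)} : u\in\mathbb{R}^d\setminus\{0\}\right\}.$$
   Context: $\langle\cdot,\cdot\rangle$ is the standard inner product on $\mathbb{R}^d$, $\overline{\mathbb{R}}=\mathbb{R}\cup\{+\infty,-\infty\}$, and $A-A=\{x-y : x,y\in A\}$. The functions and quantities below take values in $\overline{\mathbb{R}}$. Support function of $A\subseteq\mathbb{R}^d$: $h_A(x)=\sup\{\langle x,y\rangle : y\in A\}$. Minkowski functional of $C$: $\gamma_C(x)=\inf\{\lambda>0 : x\in\lambda C\}$. Circumradius of a set $A\subseteq\mathbb{R}^d$ with respect to a non-empty closed convex set $C\subseteq\mathbb{R}^d$: $R(A,C)=\inf_{x\in\mathbb{R}^d}\inf\{\lambda>0 : A\subseteq x+\lambda C\}$. Maximal chord-length function of $A\subseteq\mathbb{R}^d$: $l_A(x)=\sup\{\alpha>0 : \alpha x\in A-A\}$.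
   Formalization: The supremum of an empty set is read as 0, also in h and l; with the value −∞ the last identity fails when K is a single point (l_K(u) = −∞ but R({x,x},C) = 0) and the first chain fails when K is empty. *)

theory Defs
  imports "HOL-Analysis.Analysis"
begin

text \<open>
  All quantities are extended reals. In \<^typ>\<open>ereal\<close> the supremum of the empty set is
  \<open>-\<infinity>\<close>; here it is \<open>0\<close>, because circumradii, Minkowski functionals, chord
  lengths and support functions of difference sets are read as quantities in \<open>[0, \<infinity>]\<close>.
  With \<open>-\<infinity>\<close>, a singleton would have chord length \<open>-\<infinity>\<close> but circumradius
  \<open>0\<close>. The convention matters only for chord lengths in directions without chords and for the
  empty set. The infimum of the empty set is \<open>\<infinity>\<close>.
\<close>

definition sup0 :: "ereal set \<Rightarrow> ereal" where
  "sup0 S = (if S = {} then 0 else Sup S)"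

definition difference_set :: "'a::ab_group_add set \<Rightarrow> 'a set" where
  "difference_set A = {x - y | x y. x \<in> A \<and> y \<in> A}"

definition support_function :: "'a::real_inner set \<Rightarrow> 'a \<Rightarrow> ereal" where
  "support_function A x = sup0 {ereal (x \<bullet> y) | y. y \<in> A}"

definition minkowski_functional :: "'a::real_vector set \<Rightarrow> 'a \<Rightarrow> ereal" where
  "minkowski_functional C x = Inf {ereal l | l. l > 0 \<and> x \<in> (*\<^sub>R) l ` C}"

definition circumradius :: "'a::real_vector set \<Rightarrow> 'a set \<Rightarrow> ereal" where
  "circumradius A C =
     (INF x. Inf {ereal l | l. l > 0 \<and> A \<subseteq> (+) x ` ((*\<^sub>R) l ` C)})"

definition max_chord_length :: "'a::real_vector set \<Rightarrow> 'a \<Rightarrow> ereal" where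
  "max_chord_length A x = sup0 {ereal a | a. a > 0 \<and> a *\<^sub>R x \<in> difference_set A}"

end

theory Submission
  imports Defs
begin

text \<open>
  Write \<open>L = K - K\<close> and \<open>D = C - C\<close>. Two nonnegative extended reals agree as soon as they have
  the same positive real upper bounds, and for every \<open>t > 0\<close> each of the first three quantities
  (without the factor \<open>2\<close>), as well as the supremum of the chord-length ratios, is at most \<open>t\<close>
  iff \<open>L \<subseteq> t D\<close>. For support functions this is separation of a point from a compact convex set;
  for the circumradius of a pair it is the identity \<open>R({x, y}, C) = \<gamma>\<^sub>D(x - y)\<close>. For
  \<open>R(L, B)\<close> one averages an inclusion \<open>L \<subseteq> z + l B\<close> with \<open>L \<subseteq> - z - l B\<close>, which holds
  because \<open>L = - L\<close>, to get \<open>L \<subseteq> (l / 2) (B - B)\<close>. With \<open>B = D / 2\<close> this is \<open>L \<subseteq> (l / 2) D\<close>;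
  with \<open>B = C\<close> it bounds \<open>R(L, D / 2)\<close> by \<open>R(L, C)\<close>.
\<close>

section \<open>Comparing extended reals through positive real upper bounds\<close>

text \<open>Any \<open>s\<close> above \<open>b\<close> leaves room for a real \<open>t\<close>
  strictly between, and \<open>0 <= b\<close> makes \<open>t\<close> positive. Testing only positive
  \<open>t\<close> matters because \<open>t\<close> will serve as a dilation factor.\<close>

lemma ereal_le_by_pos_bounds:
  fixes a b :: ereal
  assumes "0 \<le> b" and bounds: "\<And>t::real. t > 0 \<Longrightarrow> b \<le> ereal t \<Longrightarrow> a \<le> ereal t"
  shows "a \<le> b"
proof (rule dense_ge)
  fix s assume s: "b < s"
  then obtain t where t: "b < ereal t" "ereal t < s"
    using ereal_dense2 by blast
  then have "t > 0"
    using assms(1) by (metis ereal_less(2) order_le_less_trans)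
  then show "a \<le> s"
    using bounds[of t] t by (meson less_imp_le order_trans)
qed

lemma ereal_eq_by_pos_bounds:
  fixes a b :: ereal
  assumes "0 \<le> a" "0 \<le> b"
    and "\<And>t::real. t > 0 \<Longrightarrow> a \<le> ereal t \<longleftrightarrow> b \<le> ereal t"
  shows "a = b"
proof (rule antisym)
  show "a \<le> b" using assms(2,3) by (blast intro: ereal_le_by_pos_bounds)
  show "b \<le> a" using assms(1,3) by (blast intro: ereal_le_by_pos_bounds)
qed

text \<open>The condition on \<open>t\<close> covers the empty set, for which the right side is
  vacuous and \<open>sup0\<close> is 0.\<close>

lemma sup0_le_iff: "0 \<le> t \<Longrightarrow> sup0 S \<le> t \<longleftrightarrow> (\<forall>x\<in>S. x \<le> t)"
  by (auto simp: sup0_def Sup_le_iff)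

lemma sup0_nonneg: "(\<And>x. x \<in> S \<Longrightarrow> 0 \<le> x) \<Longrightarrow> 0 \<le> sup0 S"
  by (auto simp: sup0_def) (metis Sup_upper2 ex_in_conv)

lemma sup0_upper: "x \<in> S \<Longrightarrow> x \<le> sup0 S"
  by (auto simp: sup0_def intro: Sup_upper)

section \<open>Dilates of convex sets and Minkowski functionals\<close>

text \<open>A convex set containing 0 is star-shaped about 0: \<open>(s / t) b\<close> lies on the
  segment from 0 to \<open>b\<close>.\<close>

lemma convex_scaleR_image_mono:
  assumes "convex B" "0 \<in> B" "0 < s" "s \<le> t"
  shows "(*\<^sub>R) s ` B \<subseteq> (*\<^sub>R) t ` B"
proof
  fix x assume "x \<in> (*\<^sub>R) s ` B"
  then obtain b where b: "b \<in> B" "x = s *\<^sub>R b" by auto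
  have "(1 - s / t) *\<^sub>R 0 + (s / t) *\<^sub>R b \<in> B"
    using assms b by (intro convexD) auto
  moreover have "x = t *\<^sub>R ((s / t) *\<^sub>R b)"
    using assms b by simp
  ultimately show "x \<in> (*\<^sub>R) t ` B" by (metis add_0 image_eqI scaleR_zero_right)
qed

lemma mem_scaleR_image_iff:
  fixes x :: "'a::real_vector"
  assumes "t \<noteq> 0"
  shows "x \<in> (*\<^sub>R) t ` B \<longleftrightarrow> (1 / t) *\<^sub>R x \<in> B"
proof
  assume "(1 / t) *\<^sub>R x \<in> B"
  moreover have "x = t *\<^sub>R ((1 / t) *\<^sub>R x)" using assms by simp
  ultimately show "x \<in> (*\<^sub>R) t ` B" by (rule rev_image_eqI)
qed (use assms in auto)

text \<open>The points \<open>x / (t + 1 / (n + 1))\<close> lie in \<open>B\<close> and converge to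
  \<open>x / t\<close>. This replaces attainment of the infima that define Minkowski functional and
  circumradius.\<close>

lemma closed_mem_scaleR_image_limit:
  fixes B :: "'a::real_normed_vector set"
  assumes "closed B" "t > 0" and mem: "\<And>s. s > t \<Longrightarrow> x \<in> (*\<^sub>R) s ` B"
  shows "x \<in> (*\<^sub>R) t ` B"
proof -
  have "(\<lambda>n. (1 / (t + inverse (real (Suc n)))) *\<^sub>R x) \<longlonglongrightarrow> (1 / (t + 0)) *\<^sub>R x"
    using assms(2) by (intro tendsto_intros LIMSEQ_inverse_real_of_nat) auto
  moreover have "(1 / (t + inverse (real (Suc n)))) *\<^sub>R x \<in> B" for n
    using mem[of "t + inverse (real (Suc n))"] assms(2)
      mem_scaleR_image_iff[of "t + inverse (real (Suc n))" x B]
    by (smt (verit) inverse_positive_iff_positive of_nat_0_less_iff zero_less_Suc)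
  ultimately have "(1 / t) *\<^sub>R x \<in> B"
    using closed_sequentially[OF assms(1), of "\<lambda>n. (1 / (t + inverse (real (Suc n)))) *\<^sub>R x"]
    by simp
  then show ?thesis using assms(2) by (simp add: mem_scaleR_image_iff)
qed

lemma minkowski_functional_le:
  "t > 0 \<Longrightarrow> x \<in> (*\<^sub>R) t ` B \<Longrightarrow> minkowski_functional B x \<le> ereal t"
  unfolding minkowski_functional_def by (rule Inf_lower) auto

lemma minkowski_functional_nonneg: "0 \<le> minkowski_functional B x"
  unfolding minkowski_functional_def by (rule Inf_greatest) auto

lemma minkowski_functional_less_iff:
  "minkowski_functional B x < ereal s \<longleftrightarrow> (\<exists>l. 0 < l \<and> l < s \<and> x \<in> (*\<^sub>R) l ` B)"
proof
  assume "minkowski_functional B x < ereal s"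
  then show "\<exists>l. 0 < l \<and> l < s \<and> x \<in> (*\<^sub>R) l ` B"
    unfolding minkowski_functional_def Inf_less_iff by auto
next
  assume "\<exists>l. 0 < l \<and> l < s \<and> x \<in> (*\<^sub>R) l ` B"
  then obtain l where "0 < l" "l < s" "x \<in> (*\<^sub>R) l ` B" by blast
  then show "minkowski_functional B x < ereal s"
    using minkowski_functional_le by (metis less_ereal.simps(1) order_le_less_trans)
qed

text \<open>A bound \<open>t\<close> on the infimum yields, for each \<open>s > t\<close>, an
  admissible factor below \<open>s\<close>; monotonicity of dilates makes \<open>s\<close> itself
  admissible, and closedness lets \<open>s\<close> decrease to \<open>t\<close>.\<close>

lemma minkowski_functional_le_iff:
  fixes B :: "'a::real_normed_vector set"
  assumes "closed B" "convex B" "0 \<in> B" "t > 0"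
  shows "minkowski_functional B x \<le> ereal t \<longleftrightarrow> x \<in> (*\<^sub>R) t ` B"
proof
  assume le: "minkowski_functional B x \<le> ereal t"
  show "x \<in> (*\<^sub>R) t ` B"
  proof (rule closed_mem_scaleR_image_limit[OF assms(1,4)])
    fix s assume "t < s"
    then have "minkowski_functional B x < ereal s"
      using le by (simp add: order_le_less_trans)
    then show "x \<in> (*\<^sub>R) s ` B"
      unfolding minkowski_functional_less_iff
      using convex_scaleR_image_mono[OF assms(2,3)] by (meson less_imp_le subsetD)
  qed
qed (use assms minkowski_functional_le in auto)

section \<open>Circumradii, in general and for pairs\<close>

lemma circumradius_le:
  assumes "t > 0" "A \<subseteq> (+) z ` ((*\<^sub>R) t ` B)"
  shows "circumradius A B \<le> ereal t"
  unfolding circumradius_def by (rule INF_lower2[of z]) (use assms in \<open>auto intro!: Inf_lower\<close>)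

lemma circumradius_nonneg: "0 \<le> circumradius A B"
  unfolding circumradius_def by (intro INF_greatest Inf_greatest) auto

text \<open>The strict form needs no attainment of either infimum, so no limiting centre has to be
  constructed.\<close>

lemma circumradius_less_iff:
  "circumradius A B < ereal s \<longleftrightarrow> (\<exists>l z. 0 < l \<and> l < s \<and> A \<subseteq> (+) z ` ((*\<^sub>R) l ` B))"
proof
  assume "circumradius A B < ereal s"
  then obtain z where "Inf {ereal l |l. 0 < l \<and> A \<subseteq> (+) z ` (*\<^sub>R) l ` B} < ereal s"
    unfolding circumradius_def INF_less_iff by blast
  then obtain l where "0 < l" "l < s" "A \<subseteq> (+) z ` ((*\<^sub>R) l ` B)"
    unfolding Inf_less_iff by auto
  then show "\<exists>l z. 0 < l \<and> l < s \<and> A \<subseteq> (+) z ` ((*\<^sub>R) l ` B)" by blast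
next
  assume "\<exists>l z. 0 < l \<and> l < s \<and> A \<subseteq> (+) z ` ((*\<^sub>R) l ` B)"
  then obtain l z where "0 < l" "l < s" "A \<subseteq> (+) z ` ((*\<^sub>R) l ` B)" by blast
  then show "circumradius A B < ereal s"
    using circumradius_le by (metis less_ereal.simps(1) order_le_less_trans)
qed

text \<open>If \<open>x = z + l c\<close> and \<open>y = z + l c'\<close>, the centre cancels in
  \<open>x - y = l (c - c')\<close>. Conversely, the centre \<open>x - l c\<close> puts
  \<open>x\<close> at \<open>c\<close> and \<open>y\<close> at \<open>c'\<close>.\<close>

lemma circumradius_pair:
  "circumradius {x, y} C = minkowski_functional (difference_set C) (x - y)"
proof (rule antisym)
  show "circumradius {x, y} C \<le> minkowski_functional (difference_set C) (x - y)"
    unfolding minkowski_functional_def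
  proof (rule Inf_greatest)
    fix r assume "r \<in> {ereal l |l. 0 < l \<and> x - y \<in> (*\<^sub>R) l ` difference_set C}"
    then obtain l c c' where l: "r = ereal l" "l > 0" and c: "c \<in> C" "c' \<in> C"
      and "x - y = l *\<^sub>R (c - c')"
      by (auto simp: difference_set_def)
    then have "y = (x - l *\<^sub>R c) + l *\<^sub>R c'" by (simp add: algebra_simps)
    moreover have "x = (x - l *\<^sub>R c) + l *\<^sub>R c" by simp
    ultimately have "{x, y} \<subseteq> (+) (x - l *\<^sub>R c) ` ((*\<^sub>R) l ` C)"
      using c by blast
    then show "circumradius {x, y} C \<le> r"
      using l circumradius_le by blast
  qed
  have "minkowski_functional (difference_set C) (x - y) \<le> ereal l"
    if l: "l > 0" "{x, y} \<subseteq> (+) z ` ((*\<^sub>R) l ` C)" for l z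
  proof -
    obtain c c' where "c \<in> C" "c' \<in> C" "x = z + l *\<^sub>R c" "y = z + l *\<^sub>R c'"
      using l(2) by auto
    then have "x - y = l *\<^sub>R (c - c')" by (simp add: algebra_simps)
    moreover have "c - c' \<in> difference_set C"
      using \<open>c \<in> C\<close> \<open>c' \<in> C\<close> unfolding difference_set_def by blast
    ultimately show ?thesis using l(1) by (intro minkowski_functional_le) auto
  qed
  then show "minkowski_functional (difference_set C) (x - y) \<le> circumradius {x, y} C"
    unfolding circumradius_def by (intro INF_greatest Inf_greatest) auto
qed

section \<open>Difference sets and central symmetry\<close>

lemma uminus_mem_difference_set: "x \<in> difference_set A \<Longrightarrow> - x \<in> difference_set A"
  unfolding difference_set_def mem_Collect_eq by (metis minus_diff_eq)

lemma zero_mem_difference_set: "A \<noteq> {} \<Longrightarrow> 0 \<in> difference_set A"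
  by (auto simp: difference_set_def)

lemma difference_set_subset_iff:
  "difference_set A \<subseteq> B \<longleftrightarrow> (\<forall>x\<in>A. \<forall>y\<in>A. x - y \<in> B)"
  by (auto simp: difference_set_def)

lemma compact_difference_set:
  fixes A :: "'a::real_normed_vector set"
  shows "compact A \<Longrightarrow> compact (difference_set A)"
  unfolding difference_set_def by (rule compact_differences)

lemma convex_difference_set:
  assumes "convex A"
  shows "convex (difference_set A)"
proof -
  have "difference_set A = (\<Union>x\<in>A. \<Union>y\<in>A. {x - y})"
    by (auto simp: difference_set_def)
  then show ?thesis
    using convex_differences[OF assms assms] by simp
qed

text \<open>The inclusion is used at both \<open>x\<close> and \<open>- x\<close>; subtracting the
  two representations eliminates the centre and leaves \<open>2 x = l (b - b')\<close>.\<close>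

lemma subset_half_difference_set:
  fixes A B :: "'a::real_vector set"
  assumes sym: "\<And>x. x \<in> A \<Longrightarrow> - x \<in> A" and sub: "A \<subseteq> (+) z ` ((*\<^sub>R) l ` B)"
  shows "A \<subseteq> (*\<^sub>R) (l / 2) ` difference_set B"
proof
  fix x assume x: "x \<in> A"
  obtain b where b: "b \<in> B" and x_eq: "x = z + l *\<^sub>R b"
    using subsetD[OF sub x] by blast
  obtain b' where b': "b' \<in> B" and mx_eq: "- x = z + l *\<^sub>R b'"
    using subsetD[OF sub sym[OF x]] by blast
  have "2 *\<^sub>R x = x - (- x)" by (simp add: scaleR_2)
  also have "\<dots> = (z + l *\<^sub>R b) - (z + l *\<^sub>R b')" by (simp only: mx_eq) (simp only: x_eq)
  also have "\<dots> = l *\<^sub>R (b - b')" by (simp add: algebra_simps)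
  finally have "(1 / 2) *\<^sub>R (2 *\<^sub>R x) = (l / 2) *\<^sub>R (b - b')" by simp
  then have "x = (l / 2) *\<^sub>R (b - b')" by simp
  then show "x \<in> (*\<^sub>R) (l / 2) ` difference_set B"
    using b b' by (auto simp: difference_set_def)
qed

text \<open>By symmetry \<open>(b - b') / 2\<close> is the midpoint of two points \<open>b\<close>
  and \<open>- b'\<close> of \<open>B\<close>. The other inclusion is the averaging argument with
  centre 0 and radius 1.\<close>

lemma half_difference_set_eq:
  fixes B :: "'a::real_vector set"
  assumes "convex B" "B = uminus ` B"
  shows "(*\<^sub>R) (1 / 2) ` difference_set B = B"
proof
  show "(*\<^sub>R) (1 / 2) ` difference_set B \<subseteq> B"
  proof clarify
    fix w assume "w \<in> difference_set B"
    then obtain b b' where b: "b \<in> B" "b' \<in> B" "w = b - b'" by (auto simp: difference_set_def)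
    then have "- b' \<in> B" using assms(2) by blast
    then have "(1 / 2) *\<^sub>R b + (1 / 2) *\<^sub>R (- b') \<in> B"
      using assms(1) b by (intro convexD) auto
    then show "(1 / 2) *\<^sub>R w \<in> B" by (simp add: b algebra_simps)
  qed
  have sym: "\<And>x. x \<in> B \<Longrightarrow> - x \<in> B" using assms(2) by blast
  have "B \<subseteq> (+) 0 ` ((*\<^sub>R) 1 ` B)" by (simp add: image_image)
  from subset_half_difference_set[OF sym this]
  show "B \<subseteq> (*\<^sub>R) (1 / 2) ` difference_set B" .
qed

text \<open>No centre is known for the radius \<open>t\<close> itself. Averaging removes the centre
  at every radius \<open>l < 2 s\<close> with \<open>s > t / 2\<close>, so the limit only concerns
  dilates of one closed set.\<close>

lemma circumradius_le_imp_subset_half_difference_set: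
  fixes A B :: "'a::real_normed_vector set"
  assumes B: "compact B" "convex B" "B \<noteq> {}" and sym: "\<And>x. x \<in> A \<Longrightarrow> - x \<in> A" and "t > 0"
    and le: "circumradius A B \<le> ereal t"
  shows "A \<subseteq> (*\<^sub>R) (t / 2) ` difference_set B"
proof
  fix x assume x: "x \<in> A"
  note D = compact_imp_closed[OF compact_difference_set[OF B(1)]]
    convex_difference_set[OF B(2)] zero_mem_difference_set[OF B(3)]
  show "x \<in> (*\<^sub>R) (t / 2) ` difference_set B"
  proof (rule closed_mem_scaleR_image_limit[OF D(1)])
    fix s assume "t / 2 < s"
    then have "circumradius A B < ereal (2 * s)"
      by (intro order_le_less_trans[OF le]) auto
    then obtain l z where l: "0 < l" "l < 2 * s" "A \<subseteq> (+) z ` ((*\<^sub>R) l ` B)"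
      unfolding circumradius_less_iff by blast
    then have "x \<in> (*\<^sub>R) (l / 2) ` difference_set B"
      using subset_half_difference_set[OF sym l(3)] x by blast
    then show "x \<in> (*\<^sub>R) s ` difference_set B"
      using convex_scaleR_image_mono[OF D(2,3), of "l / 2" s] l by auto
  qed (use \<open>t > 0\<close> in auto)
qed

lemma circumradius_le_if_subset:
  assumes "t > 0" "A \<subseteq> (*\<^sub>R) t ` B"
  shows "circumradius A B \<le> ereal t"
proof -
  have "A \<subseteq> (+) 0 ` ((*\<^sub>R) t ` B)" using assms(2) by (simp add: image_image)
  then show ?thesis using assms(1) circumradius_le by blast
qed

text \<open>The halved difference set \<open>?H\<close> is compact, convex and symmetric, hence
  equal to its own halved difference set; so averaging loses nothing here. The converse uses the
  centre 0.\<close>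

lemma circumradius_half_difference_set_le_iff:
  fixes A B :: "'a::real_normed_vector set"
  assumes B: "compact B" "convex B" "B \<noteq> {}" and sym: "\<And>x. x \<in> A \<Longrightarrow> - x \<in> A" and "t > 0"
  shows "circumradius A ((*\<^sub>R) (1 / 2) ` difference_set B) \<le> ereal t
    \<longleftrightarrow> A \<subseteq> (*\<^sub>R) (t / 2) ` difference_set B"
proof
  let ?H = "(*\<^sub>R) (1 / 2) ` difference_set B"
  have "convex ?H" using convex_difference_set[OF B(2)] by (rule convex_scaling)
  moreover have "compact ?H" using compact_difference_set[OF B(1)] by (rule compact_scaling)
  moreover have "?H \<noteq> {}" using zero_mem_difference_set[OF B(3)] by blast
  moreover have "- x \<in> ?H" if "x \<in> ?H" for x
    using that uminus_mem_difference_set by (metis (no_types, lifting) image_iff scaleR_minus_right)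
  then have "?H = uminus ` ?H" by (metis image_eqI minus_minus subsetI subset_antisym image_subsetI)
  ultimately have sub: "circumradius A ?H \<le> ereal t \<Longrightarrow> A \<subseteq> (*\<^sub>R) (t / 2) ` difference_set ?H"
      and H: "(*\<^sub>R) (1 / 2) ` difference_set ?H = ?H"
    using circumradius_le_imp_subset_half_difference_set[of ?H A, OF _ _ _ sym \<open>t > 0\<close>]
      half_difference_set_eq[of ?H] by simp_all
  \<comment> \<open>Splitting \<open>t / 2\<close> as \<open>t\<close> times \<open>1 / 2\<close>
    exposes the halved difference set of \<open>?H\<close>, which collapses to
    \<open>?H\<close>.\<close>
  have "(*\<^sub>R) (t / 2) ` difference_set ?H = (*\<^sub>R) t ` ((*\<^sub>R) (1 / 2) ` difference_set ?H)"
    by (simp only: image_image) simp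
  then have "A \<subseteq> (*\<^sub>R) t ` ?H" if "circumradius A ?H \<le> ereal t"
    using sub[OF that] H by simp
  then show "A \<subseteq> (*\<^sub>R) (t / 2) ` difference_set B" if "circumradius A ?H \<le> ereal t"
    using that by (simp add: image_image)
  show "circumradius A ?H \<le> ereal t" if "A \<subseteq> (*\<^sub>R) (t / 2) ` difference_set B"
    using that by (intro circumradius_le_if_subset \<open>t > 0\<close>) (simp add: image_image)
qed

section \<open>Support functions and inclusion of convex sets\<close>

text \<open>Compactness gives a maximiser and a ball around 0 makes the maximum positive. Thus the
  denominators of the support function ratios are finite and positive.\<close>

lemma support_function_eq_inner:
  fixes B :: "'a::euclidean_space set"
  assumes "compact B" "0 \<in> interior B" "u \<noteq> 0"
  obtains b where "b \<in> B" "0 < u \<bullet> b" "support_function B u = ereal (u \<bullet> b)"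
proof -
  obtain e where e: "e > 0" "cball 0 e \<subseteq> B"
    using assms(2) by (auto simp: mem_interior_cball)
  have ne: "B \<noteq> {}" using assms(2) interior_subset by blast
  obtain b where b: "b \<in> B" "\<forall>y\<in>B. u \<bullet> y \<le> u \<bullet> b"
    using continuous_attains_sup[OF assms(1) ne, of "\<lambda>y. u \<bullet> y"]
      continuous_on_inner[OF continuous_on_const continuous_on_id] by blast
  \<comment> \<open>This point has norm \<open>e\<close>, hence lies in the ball, and its inner
    product with \<open>u\<close> is \<open>e * norm u > 0\<close>.\<close>
  have "(e / norm u) *\<^sub>R u \<in> B" using e by (intro subsetD[OF e(2)]) (use assms(3) in auto)
  then have "u \<bullet> ((e / norm u) *\<^sub>R u) \<le> u \<bullet> b" using b(2) by blast
  moreover have "0 < u \<bullet> ((e / norm u) *\<^sub>R u)" using e(1) assms(3) by simp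
  ultimately have "0 < u \<bullet> b" by linarith
  moreover have "support_function B u = ereal (u \<bullet> b)"
    unfolding support_function_def sup0_def using b
    by (auto intro!: antisym Sup_least Sup_upper)
  ultimately show ?thesis using that b(1) by blast
qed

text \<open>Clears the positive denominator. Phrasing the maximum over \<open>B\<close> as existence
  of a suitable \<open>b\<close> gives a criterion in real numbers only, ready for
  separation.\<close>

lemma support_function_divide_le_iff:
  fixes A B :: "'a::euclidean_space set"
  assumes "compact B" "0 \<in> interior B" "u \<noteq> 0" "t > 0"
  shows "support_function A u / support_function B u \<le> ereal t
    \<longleftrightarrow> (\<forall>a\<in>A. \<exists>b\<in>B. u \<bullet> a \<le> t * (u \<bullet> b))"
proof -
  obtain b where b: "b \<in> B" "0 < u \<bullet> b" "support_function B u = ereal (u \<bullet> b)"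
    using support_function_eq_inner[OF assms(1-3)] .
  have max: "u \<bullet> y \<le> u \<bullet> b" if "y \<in> B" for y
  proof -
    have "ereal (u \<bullet> y) \<le> support_function B u"
      unfolding support_function_def using that by (intro sup0_upper) auto
    then show ?thesis by (simp add: b(3))
  qed
  have "support_function A u / support_function B u \<le> ereal t
      \<longleftrightarrow> support_function A u \<le> ereal (t * (u \<bullet> b))"
    using b(2) by (simp add: b(3) ereal_divide_le_pos mult.commute)
  also have "\<dots> \<longleftrightarrow> (\<forall>a\<in>A. u \<bullet> a \<le> t * (u \<bullet> b))"
    unfolding support_function_def using b(2) assms(4) by (subst sup0_le_iff) auto
  also have "\<dots> \<longleftrightarrow> (\<forall>a\<in>A. \<exists>b\<in>B. u \<bullet> a \<le> t * (u \<bullet> b))"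
    using b(1) max assms(4) by (meson mult_left_mono less_imp_le order_trans)
  finally show ?thesis .
qed

lemma subset_scaleR_image_iff_inner:
  fixes A B :: "'a::euclidean_space set"
  assumes "compact B" "convex B" "t > 0"
  shows "A \<subseteq> (*\<^sub>R) t ` B \<longleftrightarrow> (\<forall>u. u \<noteq> 0 \<longrightarrow> (\<forall>a\<in>A. \<exists>b\<in>B. u \<bullet> a \<le> t * (u \<bullet> b)))"
proof
  show "\<forall>u. u \<noteq> 0 \<longrightarrow> (\<forall>a\<in>A. \<exists>b\<in>B. u \<bullet> a \<le> t * (u \<bullet> b))" if "A \<subseteq> (*\<^sub>R) t ` B"
    using that by (fastforce simp: subset_iff image_iff)
  assume inner: "\<forall>u. u \<noteq> 0 \<longrightarrow> (\<forall>a\<in>A. \<exists>b\<in>B. u \<bullet> a \<le> t * (u \<bullet> b))"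
  show "A \<subseteq> (*\<^sub>R) t ` B"
  proof (rule subsetI, rule ccontr)
    fix a assume a: "a \<in> A" "a \<notin> (*\<^sub>R) t ` B"
    have "convex ((*\<^sub>R) t ` B)" "closed ((*\<^sub>R) t ` B)"
      using assms by (auto intro: convex_scaling compact_imp_closed compact_scaling)
    \<comment> \<open>Separation puts \<open>a\<close> on the lower side of the hyperplane, so
      \<open>- v\<close> is the direction that violates \<open>inner\<close>.\<close>
    then obtain v \<beta> where v: "v \<bullet> a < \<beta>" "\<forall>x\<in>(*\<^sub>R) t ` B. \<beta> < v \<bullet> x"
      using separating_hyperplane_closed_point a(2) by metis
    \<comment> \<open>A point of \<open>B\<close> is needed to exclude \<open>v = 0\<close>, which
      would give \<open>0 < \<beta> < 0\<close>; testing \<open>inner\<close> on a basis vector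
      supplies one.\<close>
    obtain b0 where "b0 \<in> B"
      using inner a(1) nonempty_Basis nonzero_Basis by (metis ex_in_conv)
    then have "v \<noteq> 0" using v by force
    then obtain b where "b \<in> B" "(- v) \<bullet> a \<le> t * ((- v) \<bullet> b)"
      using inner a(1) by (metis neg_equal_0_iff_equal)
    then show False using v by force
  qed
qed

section \<open>Maximal chord lengths\<close>

text \<open>The parameters \<open>a\<close> with \<open>a u\<close> in the difference set form a
  compact set with a positive element, so a greatest one \<open>m\<close> exists; convexity and 0
  fill in everything between 0 and \<open>m\<close>.\<close>

lemma max_chord_length_eq:
  fixes C :: "'a::euclidean_space set"
  assumes "compact C" "convex C" "0 \<in> interior C" "u \<noteq> 0"
  obtains m where "m > 0" "max_chord_length C u = ereal m"
    "\<And>a. a > 0 \<Longrightarrow> a *\<^sub>R u \<in> difference_set C \<longleftrightarrow> a \<le> m"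
proof -
  let ?D = "difference_set C"
  have 0: "0 \<in> C" using assms(3) interior_subset by blast
  have D: "compact ?D" "convex ?D" "0 \<in> ?D"
    using assms 0 by (auto intro: compact_difference_set convex_difference_set zero_mem_difference_set)
  obtain e where e: "e > 0" "cball 0 e \<subseteq> C"
    using assms(3) by (auto simp: mem_interior_cball)
  define T where "T = {a. a *\<^sub>R u \<in> ?D}"
  have "(e / norm u) *\<^sub>R u \<in> C" using e by (intro subsetD[OF e(2)]) (use assms(4) in auto)
  then have eT: "e / norm u \<in> T"
    unfolding T_def difference_set_def using 0 by force
  have "closed T"
    unfolding T_def using compact_imp_closed[OF D(1)]
    by (intro closed_vimage[unfolded vimage_def]) (auto intro!: continuous_intros)
  moreover obtain r where r: "\<forall>x\<in>?D. norm x \<le> r"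
    using compact_imp_bounded[OF D(1)] by (auto simp: bounded_iff)
  have "\<bar>a\<bar> \<le> r / norm u" if "a \<in> T" for a
    using r that assms(4) by (auto simp: T_def pos_le_divide_eq dest!: bspec)
  then have "bounded T" by (auto simp: bounded_iff)
  ultimately have "compact T" by (simp add: compact_eq_bounded_closed)
  then obtain m where m: "m \<in> T" "\<forall>a\<in>T. a \<le> m"
    using compact_attains_sup[of T] eT by blast
  have pos: "m > 0" using m(2) eT e(1) assms(4) by (smt (verit) divide_pos_pos zero_less_norm_iff)
  have iff: "a *\<^sub>R u \<in> ?D \<longleftrightarrow> a \<le> m" if a: "a > 0" for a
  proof
    assume "a \<le> m"
    then have "(1 - a / m) *\<^sub>R 0 + (a / m) *\<^sub>R (m *\<^sub>R u) \<in> ?D"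
      using D m(1) a pos by (intro convexD) (auto simp: T_def)
    then show "a *\<^sub>R u \<in> ?D" using pos by simp
  qed (use m(2) T_def in auto)
  have "{ereal a |a. 0 < a \<and> a *\<^sub>R u \<in> ?D} = {ereal a |a. 0 < a \<and> a \<le> m}"
    using iff by blast
  then have "max_chord_length C u = ereal m"
    unfolding max_chord_length_def sup0_def using pos
    by (auto intro!: antisym Sup_least Sup_upper)
  then show ?thesis using that pos iff by blast
qed

lemma max_chord_length_divide_le_iff:
  fixes C :: "'a::euclidean_space set"
  assumes "compact C" "convex C" "0 \<in> interior C" "u \<noteq> 0" "t > 0"
  shows "max_chord_length K u / max_chord_length C u \<le> ereal t \<longleftrightarrow>
    (\<forall>a>0. a *\<^sub>R u \<in> difference_set K \<longrightarrow> a *\<^sub>R u \<in> (*\<^sub>R) t ` difference_set C)"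
proof -
  obtain m where m: "m > 0" "max_chord_length C u = ereal m"
    "\<And>a. a > 0 \<Longrightarrow> a *\<^sub>R u \<in> difference_set C \<longleftrightarrow> a \<le> m"
    using max_chord_length_eq[OF assms(1-4)] by blast
  have "max_chord_length K u / max_chord_length C u \<le> ereal t
      \<longleftrightarrow> max_chord_length K u \<le> ereal (t * m)"
    using m(1) by (simp add: m(2) ereal_divide_le_pos mult.commute)
  \<comment> \<open>If \<open>K\<close> has no chord in direction \<open>u\<close>, its chord length
    is 0 by the convention in \<open>sup0\<close>, and both sides hold.\<close>
  also have "\<dots> \<longleftrightarrow> (\<forall>a>0. a *\<^sub>R u \<in> difference_set K \<longrightarrow> a \<le> t * m)"
    unfolding max_chord_length_def using m(1) assms(5) by (subst sup0_le_iff) auto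
  also have "\<dots> \<longleftrightarrow> (\<forall>a>0. a *\<^sub>R u \<in> difference_set K \<longrightarrow> a *\<^sub>R u \<in> (*\<^sub>R) t ` difference_set C)"
  proof -
    have "a *\<^sub>R u \<in> (*\<^sub>R) t ` difference_set C \<longleftrightarrow> a \<le> t * m" if "a > 0" for a
      using m(3)[of "a / t"] that assms(5) by (simp add: mem_scaleR_image_iff field_simps)
    then show ?thesis by blast
  qed
  finally show ?thesis .
qed

section \<open>Inclusion criteria for all quantities, and the resulting chain\<close>

theorem theorem3p13:
  fixes K C :: "(real ^ 'n) set"
  assumes "compact C" and "convex C" and "interior C \<noteq> {}" and "0 \<in> interior C"
  shows
    "2 * sup0 {support_function (difference_set K) u / support_function (difference_set C) u
               | u. u \<noteq> 0}
       = 2 * sup0 {circumradius {x, y} C | x y. x \<in> K \<and> y \<in> K}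
     \<and> 2 * sup0 {circumradius {x, y} C | x y. x \<in> K \<and> y \<in> K}
       = circumradius (difference_set K) ((*\<^sub>R) (1 / 2) ` difference_set C)
     \<and> circumradius (difference_set K) ((*\<^sub>R) (1 / 2) ` difference_set C)
       \<le> circumradius (difference_set K) C
     \<and> circumradius (difference_set K) C
       \<le> sup0 {minkowski_functional C (x - y) | x y. x \<in> K \<and> y \<in> K}
     \<and> (C = uminus ` C \<longrightarrow>
         circumradius (difference_set K) ((*\<^sub>R) (1 / 2) ` difference_set C)
           = circumradius (difference_set K) C
         \<and> circumradius (difference_set K) C
           = sup0 {minkowski_functional C (x - y) | x y. x \<in> K \<and> y \<in> K})
     \<and> (K \<noteq> {} \<and> closed K \<and> convex K \<longrightarrow>
         sup0 {circumradius {x, y} C | x y. x \<in> K \<and> y \<in> K}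
           = sup0 {max_chord_length K u / max_chord_length C u | u. u \<noteq> 0})"
proof -
  define L D S where "L = difference_set K" and "D = difference_set C"
    and "S = sup0 {circumradius {x, y} C | x y. x \<in> K \<and> y \<in> K}"
  define G where "G = sup0 {minkowski_functional C (x - y) | x y. x \<in> K \<and> y \<in> K}"
  define H where "H = sup0 {support_function L u / support_function D u | u. u \<noteq> 0}"
  define M where "M = sup0 {max_chord_length K u / max_chord_length C u | u. u \<noteq> 0}"
  have 0: "0 \<in> C" using assms(4) interior_subset by blast
  then have ne: "C \<noteq> {}" by blast
  have D: "compact D" "convex D" "0 \<in> D"
    unfolding D_def
    using assms ne by (auto intro: compact_difference_set convex_difference_set zero_mem_difference_set)
  have "C \<subseteq> D" unfolding D_def difference_set_def using 0 by force
  then have int: "0 \<in> interior D" using assms(4) interior_mono by blast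
  have symL: "- x \<in> L" if "x \<in> L" for x using that unfolding L_def by (rule uminus_mem_difference_set)

  have S_iff: "S \<le> ereal t \<longleftrightarrow> L \<subseteq> (*\<^sub>R) t ` D" if t: "t > 0" for t
  proof -
    have "S \<le> ereal t \<longleftrightarrow> (\<forall>x\<in>K. \<forall>y\<in>K. minkowski_functional D (x - y) \<le> ereal t)"
      unfolding S_def D_def circumradius_pair using t by (subst sup0_le_iff) auto
    also have "\<dots> \<longleftrightarrow> L \<subseteq> (*\<^sub>R) t ` D"
      using minkowski_functional_le_iff[OF compact_imp_closed[OF D(1)] D(2,3) t]
      by (simp add: L_def difference_set_subset_iff)
    finally show ?thesis .
  qed
  have G_iff: "G \<le> ereal t \<longleftrightarrow> L \<subseteq> (*\<^sub>R) t ` C" if t: "t > 0" for t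
  proof -
    have "G \<le> ereal t \<longleftrightarrow> (\<forall>x\<in>K. \<forall>y\<in>K. minkowski_functional C (x - y) \<le> ereal t)"
      unfolding G_def using t by (subst sup0_le_iff) auto
    also have "\<dots> \<longleftrightarrow> L \<subseteq> (*\<^sub>R) t ` C"
      using minkowski_functional_le_iff[OF compact_imp_closed[OF assms(1)] assms(2) 0 t]
      by (simp add: L_def difference_set_subset_iff)
    finally show ?thesis .
  qed
  have H_iff: "H \<le> ereal t \<longleftrightarrow> L \<subseteq> (*\<^sub>R) t ` D" if t: "t > 0" for t
  proof -
    have "H \<le> ereal t \<longleftrightarrow> (\<forall>u. u \<noteq> 0 \<longrightarrow> support_function L u / support_function D u \<le> ereal t)"
      unfolding H_def using t by (subst sup0_le_iff) auto
    then show ?thesis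
      using support_function_divide_le_iff[OF D(1) int _ t] subset_scaleR_image_iff_inner[OF D(1,2) t]
      by simp
  qed
  have M_iff: "M \<le> ereal t \<longleftrightarrow> L \<subseteq> (*\<^sub>R) t ` D" if t: "t > 0" for t
  proof -
    have "M \<le> ereal t \<longleftrightarrow> (\<forall>u. u \<noteq> 0 \<longrightarrow> max_chord_length K u / max_chord_length C u \<le> ereal t)"
      unfolding M_def using t by (subst sup0_le_iff) auto
    also have "\<dots> \<longleftrightarrow> (\<forall>u. u \<noteq> 0 \<longrightarrow> (\<forall>a>0. a *\<^sub>R u \<in> L \<longrightarrow> a *\<^sub>R u \<in> (*\<^sub>R) t ` D))"
      using max_chord_length_divide_le_iff[OF assms(1,2,4) _ t] by (simp add: L_def D_def)
    also have "\<dots> \<longleftrightarrow> L \<subseteq> (*\<^sub>R) t ` D"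
    proof
      assume *: "\<forall>u. u \<noteq> 0 \<longrightarrow> (\<forall>a>0. a *\<^sub>R u \<in> L \<longrightarrow> a *\<^sub>R u \<in> (*\<^sub>R) t ` D)"
      show "L \<subseteq> (*\<^sub>R) t ` D"
      proof
        \<comment> \<open>A nonzero \<open>w\<close> is tested in its own direction, with
          \<open>u = w\<close> and \<open>a = 1\<close>; the zero vector lies in every dilate of
          \<open>D\<close>.\<close>
        fix w assume "w \<in> L"
        then show "w \<in> (*\<^sub>R) t ` D"
          using *[rule_format, of w 1] D(3) by (cases "w = 0") (auto simp: image_iff intro!: bexI[of _ 0])
      qed
    qed auto
    finally show ?thesis .
  qed

  \<comment> \<open>Nonnegativity is the side condition for comparison by positive bounds; for the
    two families of ratios it rests on positive finite denominators.\<close>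
  have S0: "0 \<le> S" unfolding S_def by (rule sup0_nonneg) (auto simp: circumradius_nonneg)
  have G0: "0 \<le> G" unfolding G_def by (rule sup0_nonneg) (auto simp: minkowski_functional_nonneg)
  \<comment> \<open>A nonempty \<open>L\<close> contains 0, which contributes the value 0 to the
    supremum; for empty \<open>L\<close> the value is 0 by convention.\<close>
  have supp0: "0 \<le> support_function L u" for u
  proof (cases "L = {}")
    case False
    then have "0 \<in> L" using zero_mem_difference_set[of K] by (auto simp: L_def difference_set_def)
    then show ?thesis
      unfolding support_function_def by (intro sup0_upper) (force simp: zero_ereal_def)
  qed (simp add: support_function_def sup0_def)
  have H0: "0 \<le> H"
    unfolding H_def
  proof (rule sup0_nonneg, clarify)
    fix u :: "real ^ 'n" assume "u \<noteq> 0"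
    then obtain b where "0 < u \<bullet> b" "support_function D u = ereal (u \<bullet> b)"
      using support_function_eq_inner[OF D(1) int] by blast
    then show "0 \<le> support_function L u / support_function D u"
      using supp0[of u] by (simp add: zero_le_divide_ereal)
  qed
  have M0: "0 \<le> M"
    unfolding M_def
  proof (rule sup0_nonneg, clarify)
    fix u :: "real ^ 'n" assume "u \<noteq> 0"
    then obtain m where "0 < m" "max_chord_length C u = ereal m"
      using max_chord_length_eq[OF assms(1,2,4)] by blast
    moreover have "0 \<le> max_chord_length K u"
      unfolding max_chord_length_def by (rule sup0_nonneg) auto
    ultimately show "0 \<le> max_chord_length K u / max_chord_length C u"
      by (simp add: zero_le_divide_ereal)
  qed

  have HS: "H = S" by (rule ereal_eq_by_pos_bounds) (simp_all add: H0 S0 H_iff S_iff)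
  have SM: "S = M" by (rule ereal_eq_by_pos_bounds) (simp_all add: M0 S0 M_iff S_iff)

  let ?R = "circumradius L ((*\<^sub>R) (1 / 2) ` D)"
  have R_iff: "?R \<le> ereal t \<longleftrightarrow> L \<subseteq> (*\<^sub>R) (t / 2) ` D" if "t > 0" for t
    unfolding D_def by (rule circumradius_half_difference_set_le_iff[OF assms(1,2) ne symL that])
  have SR: "2 * S = ?R"
  proof (rule ereal_eq_by_pos_bounds)
    fix t :: real assume t: "t > 0"
    \<comment> \<open>The factor 2 moves into the bound, where it matches the dilate by
      \<open>t / 2\<close> in \<open>R_iff\<close>.\<close>
    have "2 * S \<le> ereal t \<longleftrightarrow> S \<le> ereal (t / 2)"
      using S0 by (cases S) (auto simp: numeral_eq_ereal)
    then show "2 * S \<le> ereal t \<longleftrightarrow> ?R \<le> ereal t"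
      using S_iff[of "t / 2"] R_iff[OF t] t by simp
  qed (use S0 circumradius_nonneg in auto)
  have RC: "?R \<le> circumradius L C"
  proof (rule ereal_le_by_pos_bounds[OF circumradius_nonneg])
    fix t :: real assume "t > 0" "circumradius L C \<le> ereal t"
    then show "?R \<le> ereal t"
      using circumradius_le_imp_subset_half_difference_set[OF assms(1,2) ne symL] R_iff
      by (simp add: D_def)
  qed
  \<comment> \<open>A bound \<open>t\<close> on \<open>G\<close> encloses \<open>L\<close> in the
    dilate of \<open>C\<close> by \<open>t\<close> with centre 0, one of the competitors for the
    circumradius.\<close>
  have CG: "circumradius L C \<le> G"
    using G0 by (rule ereal_le_by_pos_bounds) (simp add: G_iff circumradius_le_if_subset)
  have sym: "?R = circumradius L C \<and> circumradius L C = G" if "C = uminus ` C"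
  proof -
    have half: "(*\<^sub>R) (1 / 2) ` D = C"
      unfolding D_def by (rule half_difference_set_eq[OF assms(2) that])
    \<comment> \<open>This closes the chain \<open>?R <= circumradius L C <= G\<close>: for
      symmetric \<open>C\<close> the dilate of \<open>D\<close> by \<open>t / 2\<close> is the
      dilate of \<open>C\<close> by \<open>t\<close>, the criterion for \<open>G\<close>.\<close>
    have "G \<le> ?R"
    proof (rule ereal_le_by_pos_bounds[OF circumradius_nonneg])
      fix t :: real assume t: "t > 0" "?R \<le> ereal t"
      then have "L \<subseteq> (*\<^sub>R) t ` ((*\<^sub>R) (1 / 2) ` D)"
        using R_iff by (simp add: image_image)
      then show "G \<le> ereal t" using t(1) by (simp only: half G_iff)
    qed
    then show ?thesis using RC CG by (meson antisym order_trans)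
  qed
  have HS2: "2 * H = 2 * S" by (simp only: HS)
  show ?thesis
    unfolding H_def[symmetric] S_def[symmetric] M_def[symmetric] G_def[symmetric]
      L_def[symmetric] D_def[symmetric]
    by (intro conjI impI HS2 SR RC CG SM sym[THEN conjunct1] sym[THEN conjunct2])
qed

end
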